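(* Let $\mathcal H$ be a real Hilbert space, let $g,h:\mathcal H\to(-\infty,\infty]$ be proper, lower semicontinuous and convex, with $h$ continuous, and let $f:=g-h$. Assume that $\operatorname{dom}h=\mathcal H$, that $h$ is bounded on bounded subsets of $\mathcal H$, that $\inf_{u\in\mathcal H}f(u)>-\infty$, and that either $g$ or $h$ is strongly convex (i.e. $\sigma_g>0$ or $\sigma_h>0$). Suppose that Algorithm I-ADCA (described in the context) generates sequences $\{\varepsilon_k\}$, $\{u^k\}$, $\{v^k\}$, $\{w^k\}$, where $w^k$ is not a critical point of $\inf_{u\in\mathcal H}f(u)$ for each $k\in\mathbb N\cup\{0\}$, and that the sequence $\{u^k\}$ is bounded. Then the sequence $\{v^k\}$ is bounded as well, and for any subsequence $\{u^{k_j}\}$ of $\{u^k\}$ strongly converging to some $\overline u\in\mathcal H$, the limit $\overline u$ is a critical point of $\inf_{u\in\mathcal H}f(u)$, i.e. $\partial g(\overline u)\cap\partial h(\overline u)\neq\varnothing$.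
   Context: For a convex function $\varphi$ on $\mathcal H$, $\sigma_\varphi$ denotes its modulus of strong convexity: the supremum of all $\sigma\ge0$ such that $\varphi(\lambda x+(1-\lambda)y)\le\lambda\varphi(x)+(1-\lambda)\varphi(y)-\frac{\sigma}{2}\lambda(1-\lambda)\|x-y\|^2$ for all $x,y\in\mathcal H$, $\lambda\in[0,1]$. For $\varepsilon\ge 0$ and $u\in\operatorname{dom}\varphi$, $\partial_\varepsilon\varphi(u):=\{v\in\mathcal H:\langle v,u'-u\rangle\le\varphi(u')-\varphi(u)+\varepsilon\ \ \forall u'\in\mathcal H\}$, and $\partial\varphi:=\partial_0\varphi$ is the convex subdifferential. A point $u$ is a critical point of $\inf_{\mathcal H}(g-h)$ if $\partial g(u)\cap\partial h(u)\ne\varnothing$. A point $u_\varepsilon$ is an $\varepsilon$-solution of $\inf_{u\in\mathcal H}\varphi(u)$ if $\varphi(u_\varepsilon)\le\inf_{\mathcal H}\varphi+\varepsilon$. Algorithm I-ADCA. Initialization: $u^0\in\operatorname{dom}f$, a reduction factor $\gamma\in(0,1)$, $\varepsilon_0\in(0,1]$, $k=0$. Repeat: Step 1: choose $w^k\in\mathcal H$ with $f(w^k)\le f(u^k)$. Step 2: choose $v^k\in\partial_{\varepsilon_k}h(w^k)$. Step 3: choose an $\varepsilon_k$-solution $u^{k+1}$ of $\inf_{u\in\mathcal H}[g(u)-\langle v^k,u\rangle]$. Step 4: while $\varepsilon_k>\frac{\sigma_g+\sigma_h}{32}\|u^{k+1}-w^k\|^2$, set $\varepsilon_k\gets\gamma\varepsilon_k$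 and restart from Step 2 with the new $\varepsilon_k$. Step 5: choose $\varepsilon_{k+1}\in(0,\varepsilon_k]$ and set $k\gets k+1$. In the generated sequences, $\varepsilon_k$, $v^k$, $u^{k+1}$ denote the final values on exit from Step 4, so that $0<\varepsilon_k\le\frac{\sigma_g+\sigma_h}{32}\|u^{k+1}-w^k\|^2$ for every $k$. *)

theory Defs
  imports "HOL-Analysis.Analysis"
begin

text \<open>
  Functions with values in \<open>(-\<infinity>, \<infinity>]\<close> are represented as \<^typ>\<open>ereal\<close>-valued functions;
  the value \<open>-\<infinity>\<close> is excluded by \<open>proper\<close>. The Hilbert space is a type of
  sort \<open>{real_inner, complete_space}\<close>.
\<close>

definition edom :: "('a \<Rightarrow> ereal) \<Rightarrow> 'a set" where
  "edom \<phi> = {u. \<phi> u < \<infinity>}"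

definition proper :: "('a \<Rightarrow> ereal) \<Rightarrow> bool" where
  "proper \<phi> \<longleftrightarrow> (\<forall>u. \<phi> u \<noteq> -\<infinity>) \<and> edom \<phi> \<noteq> {}"

definition lsc :: "('a::topological_space \<Rightarrow> ereal) \<Rightarrow> bool" where
  "lsc \<phi> \<longleftrightarrow> (\<forall>u. \<phi> u \<le> Liminf (at u) \<phi>)"

text \<open>The convention \<open>0 * \<infinity> = 0\<close> of \<^typ>\<open>ereal\<close> makes the following inequalities
  trivial for \<open>\<lambda> \<in> {0, 1}\<close>, as they should be.\<close>

definition econvex :: "('a::real_vector \<Rightarrow> ereal) \<Rightarrow> bool" where
  "econvex \<phi> \<longleftrightarrow> (\<forall>x y. \<forall>l\<in>{0..1::real}.
     \<phi> (l *\<^sub>R x + (1 - l) *\<^sub>R y) \<le> ereal l * \<phi> x + ereal (1 - l) * \<phi> y)"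

text \<open>The supremum is taken in \<^typ>\<open>ereal\<close>, since the admissible \<open>\<sigma>\<close> are unbounded when
  the domain of \<open>\<phi>\<close> is a single point.\<close>

definition sc_modulus :: "('a::real_inner \<Rightarrow> ereal) \<Rightarrow> ereal" where
  "sc_modulus \<phi> = Sup (ereal ` {\<sigma>. \<sigma> \<ge> 0 \<and> (\<forall>x y. \<forall>l\<in>{0..1::real}.
     \<phi> (l *\<^sub>R x + (1 - l) *\<^sub>R y)
       \<le> ereal l * \<phi> x + ereal (1 - l) * \<phi> y
         - ereal (\<sigma> / 2 * l * (1 - l) * (norm (x - y))\<^sup>2))})"

text \<open>Points outside the domain have empty \<open>\<epsilon>\<close>-subdifferential.\<close>

definition eps_subdiff :: "real \<Rightarrow> ('a::real_inner \<Rightarrow> ereal) \<Rightarrow> 'a \<Rightarrow> 'a set" where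
  "eps_subdiff \<epsilon> \<phi> u =
     {v. u \<in> edom \<phi> \<and> (\<forall>u'. ereal (v \<bullet> (u' - u)) \<le> \<phi> u' - \<phi> u + ereal \<epsilon>)}"

abbreviation subdiff :: "('a::real_inner \<Rightarrow> ereal) \<Rightarrow> 'a \<Rightarrow> 'a set" where
  "subdiff \<equiv> eps_subdiff 0"

definition critical_point ::
    "('a::real_inner \<Rightarrow> ereal) \<Rightarrow> ('a \<Rightarrow> ereal) \<Rightarrow> 'a \<Rightarrow> bool" where
  "critical_point g h u \<longleftrightarrow> subdiff g u \<inter> subdiff h u \<noteq> {}"

definition eps_solution :: "real \<Rightarrow> ('a \<Rightarrow> ereal) \<Rightarrow> 'a \<Rightarrow> bool" where
  "eps_solution \<epsilon> \<phi> u \<longleftrightarrow> \<phi> u \<le> (INF u'. \<phi> u') + ereal \<epsilon>"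

definition bounded_on_bounded :: "('a::metric_space \<Rightarrow> ereal) \<Rightarrow> bool" where
  "bounded_on_bounded \<phi> \<longleftrightarrow>
     (\<forall>S. bounded S \<longrightarrow> (\<exists>M::real. \<forall>u\<in>S. \<bar>\<phi> u\<bar> \<le> ereal M))"

text \<open>\<open>iadca_inner g h \<gamma> w e \<epsilon> v u\<close>: Steps 2 to 4 of I-ADCA at the point \<open>w\<close>, entered with
  tolerance \<open>e\<close>, can exit with final tolerance \<open>\<epsilon>\<close>, final \<open>\<epsilon>\<close>-subgradient \<open>v\<close> and
  next iterate \<open>u\<close>. In the rule \<open>restart\<close>, \<open>v'\<close> and \<open>u'\<close> are the rejected choices.\<close>

inductive iadca_inner ::
    "('a::real_inner \<Rightarrow> ereal) \<Rightarrow> ('a \<Rightarrow> ereal) \<Rightarrow> real \<Rightarrow> 'a \<Rightarrow> real \<Rightarrow> real \<Rightarrow> 'a \<Rightarrow> 'a \<Rightarrow> bool"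
  for g h \<gamma> w where
  accept:
    "\<lbrakk> v \<in> eps_subdiff \<epsilon> h w;
       eps_solution \<epsilon> (\<lambda>x. g x - ereal (v \<bullet> x)) u;
       ereal \<epsilon> \<le> (sc_modulus g + sc_modulus h) / 32 * ereal ((norm (u - w))\<^sup>2) \<rbrakk>
     \<Longrightarrow> iadca_inner g h \<gamma> w \<epsilon> \<epsilon> v u"
| restart:
    "\<lbrakk> v' \<in> eps_subdiff e h w;
       eps_solution e (\<lambda>x. g x - ereal (v' \<bullet> x)) u';
       ereal e > (sc_modulus g + sc_modulus h) / 32 * ereal ((norm (u' - w))\<^sup>2);
       iadca_inner g h \<gamma> w (\<gamma> * e) \<epsilon> v u \<rbrakk>
     \<Longrightarrow> iadca_inner g h \<gamma> w e \<epsilon> v u"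

text \<open>\<open>\<epsilon>\<close>, \<open>v\<close>, \<open>u\<close> carry the final values on exit from Step 4, whereas \<open>e k\<close> is the
  tolerance with which iteration \<open>k\<close> is entered.\<close>

definition iadca_generates ::
    "('a::real_inner \<Rightarrow> ereal) \<Rightarrow> ('a \<Rightarrow> ereal) \<Rightarrow> real \<Rightarrow>
     (nat \<Rightarrow> real) \<Rightarrow> (nat \<Rightarrow> 'a) \<Rightarrow> (nat \<Rightarrow> 'a) \<Rightarrow> (nat \<Rightarrow> 'a) \<Rightarrow> bool" where
  "iadca_generates g h \<gamma> \<epsilon> u v w \<longleftrightarrow>
     u 0 \<in> edom (\<lambda>x. g x - h x) \<and> 0 < \<gamma> \<and> \<gamma> < 1 \<and>
     (\<exists>e. 0 < e 0 \<and> e 0 \<le> 1 \<and>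
        (\<forall>k. g (w k) - h (w k) \<le> g (u k) - h (u k) \<and>
             iadca_inner g h \<gamma> (w k) (e k) (\<epsilon> k) (v k) (u (Suc k)) \<and>
             0 < e (Suc k) \<and> e (Suc k) \<le> \<epsilon> k))"

end

theory Submission
  imports Defs
begin

text \<open>
  Strong convexity turns the inexact optimality conditions \<open>v\<^sup>k \<in> \<partial>\<^sub>\<epsilon> h(w\<^sup>k) \<inter> \<partial>\<^sub>\<epsilon> g(u\<^sup>k\<^sup>+\<^sup>1)\<close> and the exit test
  of Step 4 into the descent estimate
  \<open>f(w\<^sup>k) - f(u\<^sup>k\<^sup>+\<^sup>1) \<ge> (\<sigma>\<^sub>g + \<sigma>\<^sub>h)/8 \<parallel>u\<^sup>k\<^sup>+\<^sup>1 - w\<^sup>k\<parallel>\<^sup>2\<close>. Since \<open>f\<close> is bounded below, \<open>u\<^sup>k\<^sup>+\<^sup>1 - w\<^sup>k\<close> and \<open>\<epsilon>\<^sub>k\<close> tend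
  to \<open>0\<close>; hence \<open>{w\<^sup>k}\<close>, and with it \<open>{v\<^sup>k}\<close>, is bounded. If \<open>u\<^sup>k\<^sup>+\<^sup>1\<close> converges to \<open>x\<close> along a
  subsequence, then so does \<open>w\<^sup>k\<close>, and \<open>v\<^sup>k\<close> eventually belongs to \<open>\<partial>\<^sub>\<delta> g(x) \<inter> \<partial>\<^sub>\<delta> h(x)\<close> for every
  \<open>\<delta> > 0\<close>. Instead of extracting a weakly convergent subsequence of \<open>{v\<^sup>k}\<close>, we intersect these closed
  convex bounded sets: in a Hilbert space their almost-minimal-norm elements form a Cauchy sequence.
\<close>

section \<open>Nested closed convex sets in a Hilbert space\<close>

text \<open>This stands in for weak compactness. The squared minimal norms of the \<open>C n\<close>
  increase and stay bounded, hence converge, and the parallelogram law turns this into a Cauchy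
  estimate.\<close>

lemma nested_closed_convex_Inter_nonempty:
  fixes C :: "nat \<Rightarrow> 'a::{real_inner, complete_space} set"
  assumes closed: "\<And>n. closed (C n)" and convex: "\<And>n. convex (C n)"
    and ne: "\<And>n. C n \<noteq> {}" and dec: "decseq C" and bdd: "bounded (C 0)"
  shows "(\<Inter>n. C n) \<noteq> {}"
proof -
  define t where "t n = 1 / real (Suc n)" for n
  have t: "t \<longlonglongrightarrow> 0"
    unfolding t_def using LIMSEQ_inverse_real_of_nat by (simp add: divide_inverse)
  \<comment> \<open>\<open>m n\<close> is the squared distance from the origin to
    \<open>C n\<close>; the slack \<open>t n\<close> allows \<open>x n\<close> to be picked without
    knowing that the infimum is attained.\<close>
  define m where "m n = (INF x\<in>C n. (norm x)\<^sup>2)" for n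
  have bb: "bdd_below ((\<lambda>x. (norm x)\<^sup>2) ` C n)" for n
    by (rule bdd_belowI2[where m = 0]) simp
  have m_le: "m n \<le> (norm x)\<^sup>2" if "x \<in> C n" for n x
    unfolding m_def using bb that by (rule cINF_lower)
  have "\<exists>x\<in>C n. (norm x)\<^sup>2 < m n + t n" for n
    using cINF_less_iff[OF ne[of n] bb[of n], where a = "m n + t n"] by (simp add: m_def t_def)
  then obtain x where x: "\<And>n. x n \<in> C n"
    and xm: "\<And>n. (norm (x n))\<^sup>2 < m n + t n"
    by metis
  have sub: "C k \<subseteq> C n" if "n \<le> k" for n k
    using dec that by (rule decseqD)
  have inc: "incseq m"
    unfolding incseq_def m_def using ne bb sub by (intro allI impI cINF_superset_mono) auto
  obtain R where R: "\<And>y. y \<in> C 0 \<Longrightarrow> norm y \<le> R"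
    using bdd bounded_iff by blast
  have "m n \<le> R\<^sup>2" for n
  proof -
    have "norm (x n) \<le> R"
      using x[of n] sub[of 0 n] R by blast
    then have "(norm (x n))\<^sup>2 \<le> R\<^sup>2"
      by (intro power_mono) auto
    then show ?thesis using m_le[OF x[of n]] by linarith
  qed
  then obtain L where L: "m \<longlonglongrightarrow> L" and mL: "\<And>n. m n \<le> L"
    using incseq_convergent[OF inc, of "R\<^sup>2"] by auto
  have gap: "(norm (x n - x k))\<^sup>2 \<le> 2 * (L - m n) + 4 * t n" if "n \<le> k" for n k
  proof -
    \<comment> \<open>The midpoint lies in \<open>C n\<close>, so its squared norm is at least
      \<open>m n\<close>. The parallelogram law then leaves at most
      \<open>2 * (m k - m n) + 2 * t n + 2 * t k\<close>.\<close>
    have "(1/2) *\<^sub>R x n + (1/2) *\<^sub>R x k \<in> C n"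
      using convex[of n] x[of n] x[of k] sub[OF that] by (intro convexD) auto
    then have "m n \<le> (norm ((1/2) *\<^sub>R x n + (1/2) *\<^sub>R x k))\<^sup>2"
      by (rule m_le)
    also have "\<dots> = ((norm (x n))\<^sup>2 + 2 * (x n \<bullet> x k) + (norm (x k))\<^sup>2) / 4"
      by (simp add: power2_norm_eq_inner inner_add inner_commute algebra_simps)
    finally have "4 * m n \<le> (norm (x n))\<^sup>2 + 2 * (x n \<bullet> x k) + (norm (x k))\<^sup>2"
      by simp
    moreover have "(norm (x n - x k))\<^sup>2 = (norm (x n))\<^sup>2 - 2 * (x n \<bullet> x k) + (norm (x k))\<^sup>2"
      by (simp add: power2_norm_eq_inner inner_diff inner_commute algebra_simps)
    moreover have "t k \<le> t n"
      using that by (simp add: t_def frac_le)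
    ultimately show ?thesis
      using xm[of n] xm[of k] mL[of k] by argo
  qed
  have "(\<lambda>n. 2 * (L - m n) + 4 * t n) \<longlonglongrightarrow> 2 * (L - L) + 4 * 0"
    by (intro tendsto_intros L t)
  then have lim0: "(\<lambda>n. 2 * (L - m n) + 4 * t n) \<longlonglongrightarrow> 0"
    by simp
  have "Cauchy x"
  proof (rule CauchyI')
    fix e :: real assume "e > 0"
    then have "eventually (\<lambda>n. 2 * (L - m n) + 4 * t n < e\<^sup>2) sequentially"
      using order_tendstoD(2)[OF lim0, of "e\<^sup>2"] by simp
    then obtain N where N: "\<And>n. n \<ge> N \<Longrightarrow> 2 * (L - m n) + 4 * t n < e\<^sup>2"
      unfolding eventually_sequentially by blast
    have "dist (x n) (x k) < e" if "n \<ge> N" "k > n" for n k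
    proof -
      have "(norm (x n - x k))\<^sup>2 < e\<^sup>2"
        using gap[of n k] N[of n] that by simp
      then show ?thesis
        using \<open>e > 0\<close> power_less_imp_less_base[of _ 2 e] by (simp add: dist_norm)
    qed
    then show "\<exists>M. \<forall>n\<ge>M. \<forall>k>n. dist (x n) (x k) < e"
      by blast
  qed
  then obtain y where y: "x \<longlonglongrightarrow> y"
    using Cauchy_convergent convergent_def by blast
  have "y \<in> C n" for n
  proof (rule Lim_in_closed_set[OF closed _ _ y])
    show "eventually (\<lambda>k. x k \<in> C n) sequentially"
      using x sub by (intro eventually_sequentiallyI[of n]) blast
  qed simp
  then show ?thesis by blast
qed

section \<open>Approximate subdifferentials in terms of real values\<close>

lemma ereal_real_on_edom:
  assumes "proper \<phi>" "x \<in> edom \<phi>"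
  shows "\<phi> x = ereal (real_of_ereal (\<phi> x))"
  using assms by (cases "\<phi> x") (auto simp: proper_def edom_def)

text \<open>Outside \<open>edom \<phi>\<close> the right-hand side is infinite, so only test points
  of the domain constrain \<open>v\<close>, and the inequality becomes one between reals.\<close>

lemma eps_subdiff_iff:
  assumes "proper \<phi>"
  shows "v \<in> eps_subdiff \<epsilon> \<phi> u \<longleftrightarrow> u \<in> edom \<phi> \<and>
    (\<forall>x\<in>edom \<phi>. v \<bullet> (x - u) \<le> real_of_ereal (\<phi> x) - real_of_ereal (\<phi> u) + \<epsilon>)"
proof (cases "u \<in> edom \<phi>")
  case True
  then obtain a where a: "\<phi> u = ereal a"
    using ereal_real_on_edom[OF assms] by blast
  have "ereal (v \<bullet> (x - u)) \<le> \<phi> x - \<phi> u + ereal \<epsilon> \<longleftrightarrow>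
      (x \<in> edom \<phi> \<longrightarrow> v \<bullet> (x - u) \<le> real_of_ereal (\<phi> x) - real_of_ereal (\<phi> u) + \<epsilon>)" for x
    using assms a by (cases "\<phi> x") (auto simp: proper_def edom_def)
  then show ?thesis
    using True by (auto simp: eps_subdiff_def)
qed (simp add: eps_subdiff_def)

lemma closed_eps_subdiff:
  assumes "proper \<phi>"
  shows "closed (eps_subdiff \<epsilon> \<phi> u)"
proof (cases "u \<in> edom \<phi>")
  case True
  then have "eps_subdiff \<epsilon> \<phi> u = (\<Inter>x\<in>edom \<phi>.
      {v. (x - u) \<bullet> v \<le> real_of_ereal (\<phi> x) - real_of_ereal (\<phi> u) + \<epsilon>})"
    using eps_subdiff_iff[OF assms] by (auto simp: inner_commute)
  then show ?thesis
    by (auto intro: closed_halfspace_le)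
qed (simp add: eps_subdiff_def)

lemma convex_eps_subdiff:
  assumes "proper \<phi>"
  shows "convex (eps_subdiff \<epsilon> \<phi> u)"
proof (cases "u \<in> edom \<phi>")
  case True
  then have "eps_subdiff \<epsilon> \<phi> u = (\<Inter>x\<in>edom \<phi>.
      {v. (x - u) \<bullet> v \<le> real_of_ereal (\<phi> x) - real_of_ereal (\<phi> u) + \<epsilon>})"
    using eps_subdiff_iff[OF assms] by (auto simp: inner_commute)
  then show ?thesis
    by (auto intro: convex_INT convex_halfspace_le)
qed (simp add: eps_subdiff_def)

lemma eps_subdiff_mono:
  assumes "proper \<phi>" "\<epsilon> \<le> \<delta>"
  shows "eps_subdiff \<epsilon> \<phi> u \<subseteq> eps_subdiff \<delta> \<phi> u"
  using assms(2) by (fastforce simp: eps_subdiff_iff[OF assms(1)])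

text \<open>Inexact Fermat rule: moving the linear term to the other side turns approximate
  minimality into the subgradient inequality.\<close>

lemma eps_solution_imp_eps_subdiff:
  assumes \<phi>: "proper \<phi>" and sol: "eps_solution \<epsilon> (\<lambda>x. \<phi> x - ereal (v \<bullet> x)) u"
  shows "v \<in> eps_subdiff \<epsilon> \<phi> u"
proof -
  have le: "\<phi> u - ereal (v \<bullet> u) \<le> \<phi> x - ereal (v \<bullet> x) + ereal \<epsilon>" for x
    using sol add_right_mono[OF INF_lower[of x UNIV "\<lambda>x. \<phi> x - ereal (v \<bullet> x)"], of "ereal \<epsilon>"]
    unfolding eps_solution_def by simp
  obtain x0 where x0: "x0 \<in> edom \<phi>"
    using \<phi> by (auto simp: proper_def)
  \<comment> \<open>Comparison with a single point of the domain forces \<open>\<phi> u\<close> to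
    be finite.\<close>
  have u: "u \<in> edom \<phi>"
    using le[of x0] ereal_real_on_edom[OF \<phi> x0] by (cases "\<phi> u"; cases "\<phi> x0") (auto simp: edom_def)
  have "v \<bullet> (x - u) \<le> real_of_ereal (\<phi> x) - real_of_ereal (\<phi> u) + \<epsilon>" if "x \<in> edom \<phi>" for x
    using le[of x] ereal_real_on_edom[OF \<phi> that] ereal_real_on_edom[OF \<phi> u]
    by (cases "\<phi> u"; cases "\<phi> x") (auto simp: inner_diff_right)
  then show ?thesis
    using u by (simp add: eps_subdiff_iff[OF \<phi>])
qed

section \<open>The modulus of strong convexity\<close>

text \<open>Convexity makes \<open>\<sigma> = 0\<close> admissible, so the supremum is not taken
  over the empty set, where it would be \<open>-\<infinity>\<close>.\<close>

lemma sc_modulus_nonneg: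
  assumes "econvex \<phi>"
  shows "0 \<le> sc_modulus \<phi>"
  unfolding sc_modulus_def
  by (rule Sup_upper) (use assms in \<open>auto simp: econvex_def zero_ereal_def intro!: image_eqI[of _ _ 0]\<close>)

text \<open>The bound comes from testing both inequalities at the midpoint of \<open>w\<close> and \<open>x\<close>.\<close>

lemma sc_modulus_le_if_eps_subdiff:
  assumes \<phi>: "proper \<phi>" and v: "v \<in> eps_subdiff \<epsilon> \<phi> w" and x: "x \<in> edom \<phi>" and "x \<noteq> w"
  shows "sc_modulus \<phi> \<le> ereal (4 * (real_of_ereal (\<phi> x) - real_of_ereal (\<phi> w)
    - v \<bullet> (x - w) + 2 * \<epsilon>) / (norm (x - w))\<^sup>2)"
  unfolding sc_modulus_def
proof (rule Sup_least, clarify)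
  fix \<sigma> :: real
  assume sc: "\<forall>x y. \<forall>l\<in>{0..1::real}. \<phi> (l *\<^sub>R x + (1 - l) *\<^sub>R y)
       \<le> ereal l * \<phi> x + ereal (1 - l) * \<phi> y - ereal (\<sigma> / 2 * l * (1 - l) * (norm (x - y))\<^sup>2)"
  \<comment> \<open>With weight \<open>l\<close> on \<open>x\<close> the error enters as
    \<open>\<epsilon> / l\<close>, so \<open>l\<close> cannot be sent to 0 as for exact
    subgradients; a fixed weight is used.\<close>
  define z where "z = (1/2) *\<^sub>R x + (1/2) *\<^sub>R w"
  have w: "w \<in> edom \<phi>"
    using v by (simp add: eps_subdiff_def)
  have fx: "\<phi> x = ereal (real_of_ereal (\<phi> x))" and fw: "\<phi> w = ereal (real_of_ereal (\<phi> w))"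
    using ereal_real_on_edom[OF \<phi>] x w by auto
  have "\<phi> z \<le> ereal (1/2) * \<phi> x + ereal (1/2) * \<phi> w - ereal (\<sigma> / 8 * (norm (x - w))\<^sup>2)"
    using sc[rule_format, of "1/2" x w] by (simp add: z_def)
  also have "\<dots> = ereal (1/2 * real_of_ereal (\<phi> x) + 1/2 * real_of_ereal (\<phi> w) - \<sigma> / 8 * (norm (x - w))\<^sup>2)"
    by (subst fx, subst fw) simp
  finally have le: "\<phi> z \<le> ereal (1/2 * real_of_ereal (\<phi> x) + 1/2 * real_of_ereal (\<phi> w) - \<sigma> / 8 * (norm (x - w))\<^sup>2)" .
  then have z: "z \<in> edom \<phi>"
    by (auto simp: edom_def)
  have "real_of_ereal (\<phi> z) \<le> 1/2 * real_of_ereal (\<phi> x) + 1/2 * real_of_ereal (\<phi> w) - \<sigma> / 8 * (norm (x - w))\<^sup>2"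
    using le by (subst (asm) ereal_real_on_edom[OF \<phi> z]) simp
  moreover have "v \<bullet> (z - w) \<le> real_of_ereal (\<phi> z) - real_of_ereal (\<phi> w) + \<epsilon>"
    using v z by (simp add: eps_subdiff_iff[OF \<phi>])
  moreover have "v \<bullet> (z - w) = (v \<bullet> (x - w)) / 2"
    by (simp add: z_def inner_diff_right inner_add_right)
  ultimately have "\<sigma> * (norm (x - w))\<^sup>2 \<le>
      4 * (real_of_ereal (\<phi> x) - real_of_ereal (\<phi> w) - v \<bullet> (x - w) + 2 * \<epsilon>)"
    by argo
  then show "ereal \<sigma> \<le> ereal (4 * (real_of_ereal (\<phi> x) - real_of_ereal (\<phi> w)
      - v \<bullet> (x - w) + 2 * \<epsilon>) / (norm (x - w))\<^sup>2)"
    using \<open>x \<noteq> w\<close> by (simp add: pos_le_divide_eq)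
qed

section \<open>Limits of approximate subgradients\<close>

lemma lsc_eventually_gt:
  assumes "lsc \<phi>" "X \<longlonglongrightarrow> x" "c < \<phi> x"
  shows "eventually (\<lambda>j. c < \<phi> (X j)) sequentially"
proof -
  have "eventually (\<lambda>y. c < \<phi> y) (at x)"
    using assms(1,3) unfolding lsc_def le_Liminf_iff by blast
  \<comment> \<open>\<open>lsc\<close> speaks of punctured neighbourhoods;
    \<open>c < \<phi> x\<close> adds the point \<open>x\<close>, which the sequence may
    visit.\<close>
  then have "eventually (\<lambda>y. c < \<phi> y) (nhds x)"
    using assms(3) by (auto simp: eventually_at_filter elim: eventually_mono)
  then show ?thesis
    using assms(2) filterlim_iff by blast
qed

text \<open>Moving the base point from \<open>X j\<close> to \<open>x\<close> costs at most
  \<open>R * norm (X j - x) + \<epsilon> j\<close> in the linear term and the tolerance, and lower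
  semicontinuity controls the function value. Each loss is eventually below
  \<open>\<delta> / 2\<close>, whether or not \<open>v\<close> converges.\<close>

lemma eventually_eps_subdiff_limit:
  fixes X :: "nat \<Rightarrow> 'a::real_inner"
  assumes \<phi>: "proper \<phi>" "lsc \<phi>" and X: "X \<longlonglongrightarrow> x" and \<epsilon>: "\<epsilon> \<longlonglongrightarrow> 0"
    and v: "\<And>j. v j \<in> eps_subdiff (\<epsilon> j) \<phi> (X j)" and R: "\<And>j. norm (v j) \<le> R" and "\<delta> > 0"
  shows "eventually (\<lambda>j. v j \<in> eps_subdiff \<delta> \<phi> x) sequentially"
proof -
  have Xd: "X j \<in> edom \<phi>" for j
    using v by (simp add: eps_subdiff_def)
  have sub: "v j \<bullet> (y - X j) \<le> real_of_ereal (\<phi> y) - real_of_ereal (\<phi> (X j)) + \<epsilon> j"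
    if "y \<in> edom \<phi>" for y j
    using v that by (simp add: eps_subdiff_iff[OF \<phi>(1)])
  have CS: "\<bar>v j \<bullet> z\<bar> \<le> R * norm z" for j z
    using Cauchy_Schwarz_ineq2[of "v j" z] mult_right_mono[OF R[of j] norm_ge_zero[of z]] by linarith
  have x: "x \<in> edom \<phi>"
  proof (rule ccontr)
    assume "x \<notin> edom \<phi>"
    then have inf: "\<phi> x = \<infinity>"
      by (simp add: edom_def)
    obtain x0 where x0: "x0 \<in> edom \<phi>"
      using \<phi>(1) by (auto simp: proper_def)
    \<comment> \<open>The subgradient inequality tested at \<open>x0\<close> bounds
      \<open>\<phi> (X j)\<close> by a sequence converging to \<open>B\<close>, whereas
      \<open>\<phi> x = \<infinity>\<close> would push \<open>\<phi> (X j)\<close> above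
      \<open>B + 1\<close>.\<close>
    define B where "B = real_of_ereal (\<phi> x0) + R * norm (x0 - x)"
    have "(\<lambda>j. real_of_ereal (\<phi> x0) + R * norm (x0 - X j) + \<epsilon> j) \<longlonglongrightarrow> B + 0"
      unfolding B_def by (intro tendsto_intros X \<epsilon>)
    then have "eventually (\<lambda>j. real_of_ereal (\<phi> x0) + R * norm (x0 - X j) + \<epsilon> j < B + 1) sequentially"
      by (rule order_tendstoD) simp
    moreover have "eventually (\<lambda>j. ereal (B + 1) < \<phi> (X j)) sequentially"
      using inf by (intro lsc_eventually_gt[OF \<phi>(2) X]) simp
    ultimately have "eventually (\<lambda>j. False) sequentially"
    proof eventually_elim
      case (elim j)
      have "B + 1 < real_of_ereal (\<phi> (X j))"
        using elim(2) by (subst (asm) ereal_real_on_edom[OF \<phi>(1) Xd]) simp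
      then show False
        using elim(1) sub[OF x0, of j] CS[of j "x0 - X j"] by linarith
    qed
    then show False by simp
  qed
  have "(\<lambda>j. R * norm (X j - x) + \<epsilon> j) \<longlonglongrightarrow> R * norm (x - x) + 0"
    by (intro tendsto_intros X \<epsilon>)
  then have "eventually (\<lambda>j. R * norm (X j - x) + \<epsilon> j < \<delta> / 2) sequentially"
    using \<open>\<delta> > 0\<close> by (intro order_tendstoD(2)[where y = "R * norm (x - x) + 0"]) auto
  moreover have "eventually (\<lambda>j. ereal (real_of_ereal (\<phi> x) - \<delta> / 2) < \<phi> (X j)) sequentially"
    by (rule lsc_eventually_gt[OF \<phi>(2) X], subst (2) ereal_real_on_edom[OF \<phi>(1) x]) (use \<open>\<delta> > 0\<close> in simp)
  ultimately show ?thesis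
  proof eventually_elim
    case (elim j)
    have lt: "real_of_ereal (\<phi> x) - \<delta> / 2 < real_of_ereal (\<phi> (X j))"
      using elim(2) by (subst (asm) ereal_real_on_edom[OF \<phi>(1) Xd]) simp
    have "v j \<bullet> (y - x) \<le> real_of_ereal (\<phi> y) - real_of_ereal (\<phi> x) + \<delta>" if "y \<in> edom \<phi>" for y
    proof -
      have "v j \<bullet> (y - x) = v j \<bullet> (y - X j) + v j \<bullet> (X j - x)"
        by (simp add: inner_diff_right)
      then show ?thesis
        using lt elim(1) sub[OF that, of j] CS[of j "X j - x"] by linarith
    qed
    then show ?case
      using x by (simp add: eps_subdiff_iff[OF \<phi>(1)])
  qed
qed

text \<open>The base points \<open>X j\<close> and \<open>Y j\<close> differ, but they share the
  limit and the vectors \<open>v j\<close>; for each tolerance a late \<open>v j\<close> therefore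
  serves both functions at \<open>x\<close>.\<close>

lemma critical_point_limit:
  fixes g h :: "'a::{real_inner, complete_space} \<Rightarrow> ereal"
  assumes g: "proper g" "lsc g" and h: "proper h" "lsc h"
    and X: "X \<longlonglongrightarrow> x" and Y: "Y \<longlonglongrightarrow> x" and \<epsilon>: "\<epsilon> \<longlonglongrightarrow> 0"
    and vg: "\<And>j. v j \<in> eps_subdiff (\<epsilon> j) g (X j)" and vh: "\<And>j. v j \<in> eps_subdiff (\<epsilon> j) h (Y j)"
    and v: "bounded (range v)"
  shows "critical_point g h x"
proof -
  obtain R where R: "\<And>j. norm (v j) \<le> R"
    using v by (auto simp: bounded_iff)
  define d where "d n = 1 / real (Suc n)" for n
  \<comment> \<open>An approximate subdifferential can be unbounded; the ball containing all
    \<open>v j\<close> supplies boundedness without making the sets empty.\<close>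
  define C where "C n = cball 0 R \<inter> (eps_subdiff (d n) g x \<inter> eps_subdiff (d n) h x)" for n
  have d: "d n > 0" for n
    by (simp add: d_def)
  have "(\<Inter>n. C n) \<noteq> {}"
  proof (rule nested_closed_convex_Inter_nonempty)
    show "closed (C n)" for n
      unfolding C_def using g h by (intro closed_Int closed_cball closed_eps_subdiff)
    show "convex (C n)" for n
      unfolding C_def using g h by (intro convex_Int convex_cball convex_eps_subdiff)
    show "bounded (C 0)"
      unfolding C_def by blast
    show "C n \<noteq> {}" for n
    proof -
      have "eventually (\<lambda>j. v j \<in> eps_subdiff (d n) g x \<and> v j \<in> eps_subdiff (d n) h x) sequentially"
        using eventually_eps_subdiff_limit[OF g X \<epsilon> vg R d]
          eventually_eps_subdiff_limit[OF h Y \<epsilon> vh R d] by (rule eventually_conj)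
      then obtain j where "v j \<in> eps_subdiff (d n) g x \<and> v j \<in> eps_subdiff (d n) h x"
        using eventually_happens' sequentially_bot by blast
      then show ?thesis
        unfolding C_def using R[of j] by auto
    qed
    show "decseq C"
    proof (rule decseq_SucI)
      fix n
      have "d (Suc n) \<le> d n"
        by (simp add: d_def frac_le)
      then show "C (Suc n) \<subseteq> C n"
        unfolding C_def using eps_subdiff_mono[OF g(1)] eps_subdiff_mono[OF h(1)] by blast
    qed
  qed
  then obtain s where s: "\<And>n. s \<in> eps_subdiff (d n) g x" "\<And>n. s \<in> eps_subdiff (d n) h x"
    unfolding C_def by blast
  have "d \<longlonglongrightarrow> 0"
    unfolding d_def using LIMSEQ_inverse_real_of_nat by (simp add: divide_inverse)
  \<comment> \<open>The tolerances \<open>d n\<close> tend to 0; the summand \<open>+ 0\<close>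
    matches the tolerance in \<open>subdiff\<close>.\<close>
  then have le: "a \<le> b + 0" if "\<And>n. a \<le> b + d n" for a b :: real
    using that by (intro LIMSEQ_le_const[OF tendsto_add[OF tendsto_const]]) auto
  have "s \<in> subdiff \<phi> x" if "proper \<phi>" "\<And>n. s \<in> eps_subdiff (d n) \<phi> x" for \<phi>
    using that le by (simp add: eps_subdiff_iff)
  then show ?thesis
    unfolding critical_point_def using g h s by blast
qed

section \<open>Boundedness of approximate subgradients\<close>

text \<open>A unit step from \<open>w k\<close> in the direction of \<open>v k\<close> raises the
  linear term by \<open>norm (v k)\<close>, while \<open>h\<close> varies by at most
  \<open>2 * M\<close> on the ball of radius \<open>B + 1\<close>.\<close>

lemma bounded_eps_subdiff_range:
  assumes h: "proper h" "edom h = UNIV" "bounded_on_bounded h"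
    and w: "bounded (range w)" and \<epsilon>: "\<And>k. \<epsilon> k \<le> E"
    and v: "\<And>k. v k \<in> eps_subdiff (\<epsilon> k) h (w k)"
  shows "bounded (range v)"
proof -
  obtain B where B: "\<And>k. norm (w k) \<le> B"
    using w by (auto simp: bounded_iff)
  obtain M where "\<forall>x\<in>cball 0 (B + 1). \<bar>h x\<bar> \<le> ereal M"
    using h(3) bounded_cball unfolding bounded_on_bounded_def by blast
  then have M: "\<bar>real_of_ereal (h x)\<bar> \<le> M" if "norm x \<le> B + 1" for x
    using bspec[of _ _ x, OF \<open>\<forall>x\<in>cball 0 (B + 1). \<bar>h x\<bar> \<le> ereal M\<close>] that by (cases "h x") auto
  have "norm (v k) \<le> 2 * M + E" for k
  proof -
    \<comment> \<open>If \<open>v k = 0\<close>, then \<open>sgn (v k) = 0\<close>, and the identity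
      for \<open>norm (v k)\<close> below still holds.\<close>
    define y where "y = w k + sgn (v k)"
    have "norm y \<le> norm (w k) + norm (sgn (v k))"
      unfolding y_def by (rule norm_triangle_ineq)
    also have "\<dots> \<le> B + 1"
      using B[of k] by (simp add: norm_sgn)
    finally have y: "norm y \<le> B + 1" .
    have "norm (v k) = v k \<bullet> (y - w k)"
      by (simp add: y_def sgn_div_norm power2_norm_eq_inner[symmetric] power2_eq_square field_simps)
    also have "\<dots> \<le> real_of_ereal (h y) - real_of_ereal (h (w k)) + \<epsilon> k"
      using v[of k] by (simp add: eps_subdiff_iff[OF h(1)] h(2))
    also have "\<dots> \<le> 2 * M + E"
      using M[OF y] M[of "w k"] B[of k] \<epsilon>[of k] by linarith
    finally show ?thesis .
  qed
  then show ?thesis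
    by (auto simp: bounded_iff)
qed

section \<open>One iteration: exit conditions and descent\<close>

text \<open>Induction over the restarts: multiplication by \<open>\<gamma> > 0\<close> keeps the
  tolerance positive, and the other facts are the premises of \<open>accept\<close>.\<close>

lemma iadca_inner_exit:
  assumes "iadca_inner g h \<gamma> w e \<epsilon> v u" "0 < \<gamma>" "0 < e"
  shows "0 < \<epsilon> \<and> v \<in> eps_subdiff \<epsilon> h w \<and> eps_solution \<epsilon> (\<lambda>x. g x - ereal (v \<bullet> x)) u \<and>
    ereal \<epsilon> \<le> (sc_modulus g + sc_modulus h) / 32 * ereal ((norm (u - w))\<^sup>2)"
  using assms by (induction rule: iadca_inner.induct) auto

text \<open>If a modulus is infinite, then \<open>u = w\<close>, which the exit test excludes because
  \<open>\<infinity> * 0 = 0 < \<epsilon>\<close>.\<close>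

lemma iadca_descent:
  assumes g: "proper g" "econvex g" and h: "proper h" "econvex h" "edom h = UNIV"
    and w: "w \<in> edom g" and "0 < \<epsilon>"
    and vg: "v \<in> eps_subdiff \<epsilon> g u" and vh: "v \<in> eps_subdiff \<epsilon> h w"
    and exit: "ereal \<epsilon> \<le> (sc_modulus g + sc_modulus h) / 32 * ereal ((norm (u - w))\<^sup>2)"
  obtains S where "sc_modulus g + sc_modulus h = ereal S"
    "\<epsilon> \<le> S / 32 * (norm (u - w))\<^sup>2"
    "S / 8 * (norm (u - w))\<^sup>2 \<le> (real_of_ereal (g w) - real_of_ereal (h w))
       - (real_of_ereal (g u) - real_of_ereal (h u))"
proof -
  have ne: "u \<noteq> w"
    using exit \<open>0 < \<epsilon>\<close> by (auto simp: zero_ereal_def[symmetric])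
  define D where "D = (norm (u - w))\<^sup>2"
  have D: "D > 0" "(norm (w - u))\<^sup>2 = D"
    using ne by (simp_all add: D_def norm_minus_commute)
  have lg: "sc_modulus g \<le> ereal (4 * (real_of_ereal (g w) - real_of_ereal (g u)
      - v \<bullet> (w - u) + 2 * \<epsilon>) / D)"
    using sc_modulus_le_if_eps_subdiff[OF g(1) vg w] ne D by auto
  have lh: "sc_modulus h \<le> ereal (4 * (real_of_ereal (h u) - real_of_ereal (h w)
      - v \<bullet> (u - w) + 2 * \<epsilon>) / D)"
    using sc_modulus_le_if_eps_subdiff[OF h(1) vh] h(3) ne D_def by auto
  obtain sg where sg: "sc_modulus g = ereal sg"
    using sc_modulus_nonneg[OF g(2)] lg by (cases "sc_modulus g") auto
  obtain sh where sh: "sc_modulus h = ereal sh"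
    using sc_modulus_nonneg[OF h(2)] lh by (cases "sc_modulus h") auto
  have "ereal \<epsilon> \<le> (ereal sg + ereal sh) / ereal 32 * ereal D"
    using exit by (simp add: sg sh D_def)
  then have e: "\<epsilon> \<le> (sg + sh) / 32 * D"
    by simp
  have a: "sg * D \<le> 4 * (real_of_ereal (g w) - real_of_ereal (g u) - v \<bullet> (w - u) + 2 * \<epsilon>)"
    using lg D by (simp add: sg pos_le_divide_eq)
  have b: "sh * D \<le> 4 * (real_of_ereal (h u) - real_of_ereal (h w) - v \<bullet> (u - w) + 2 * \<epsilon>)"
    using lh D by (simp add: sh pos_le_divide_eq)
  \<comment> \<open>In the sum of \<open>a\<close> and \<open>b\<close> the inner products cancel
    and the error is \<open>16 * \<epsilon>\<close>. By the exit test this is at most half of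
    \<open>(sg + sh) * D\<close>; the other half, divided by 4, gives the constant 1/8.\<close>
  have "(sg + sh) / 8 * D \<le> (real_of_ereal (g w) - real_of_ereal (h w))
       - (real_of_ereal (g u) - real_of_ereal (h u))"
    using a b e inner_diff_right[of v u w] inner_diff_right[of v w u] by argo
  then show thesis
    using that[of "sg + sh"] e by (simp add: sg sh D_def)
qed

section \<open>Convergence of the generated sequences\<close>

theorem theorem3p5:
  fixes g h :: "'a::{real_inner, complete_space} \<Rightarrow> ereal"
    and \<gamma> :: real
    and \<epsilon> :: "nat \<Rightarrow> real"
    and u v w :: "nat \<Rightarrow> 'a"
  assumes g: "proper g" "lsc g" "econvex g"
    and h: "proper h" "lsc h" "econvex h" "continuous_on UNIV h"
    and dom_h: "edom h = UNIV"
    and h_bdd: "bounded_on_bounded h"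
    and inf_f: "(INF x. g x - h x) > -\<infinity>"
    and strong: "sc_modulus g > 0 \<or> sc_modulus h > 0"
    and alg: "iadca_generates g h \<gamma> \<epsilon> u v w"
    and noncrit: "\<And>k. \<not> critical_point g h (w k)"
    and u_bdd: "bounded (range u)"
  shows "bounded (range v) \<and>
         (\<forall>r ubar. strict_mono r \<longrightarrow> (u \<circ> r) \<longlonglongrightarrow> ubar \<longrightarrow> critical_point g h ubar)"
proof -
  define F where "F x = real_of_ereal (g x) - real_of_ereal (h x)" for x
  have f_real: "g x - h x = ereal (F x)" if "x \<in> edom g" for x
    using ereal_real_on_edom[OF g(1) that] ereal_real_on_edom[OF h(1), of x] dom_h
    unfolding F_def by (metis UNIV_I ereal_minus(1))
  have f_fin: "x \<in> edom g" if "g x - h x < \<infinity>" for x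
    using that ereal_real_on_edom[OF h(1), of x] dom_h
    by (cases "g x"; cases "h x") (auto simp: edom_def)
  obtain e where "0 < \<gamma>" and u0: "u 0 \<in> edom (\<lambda>x. g x - h x)" and e0: "0 < e 0"
    and step: "\<And>k. g (w k) - h (w k) \<le> g (u k) - h (u k)"
    and inner: "\<And>k. iadca_inner g h \<gamma> (w k) (e k) (\<epsilon> k) (v k) (u (Suc k))"
    and eS: "\<And>k. 0 < e (Suc k)"
    using alg unfolding iadca_generates_def by blast
  have e: "0 < e k" for k
    using e0 eS by (cases k) auto
  note exit = iadca_inner_exit[OF inner \<open>0 < \<gamma>\<close> e]
  have \<epsilon>: "0 < \<epsilon> k" and vh: "v k \<in> eps_subdiff (\<epsilon> k) h (w k)"
    and vg: "v k \<in> eps_subdiff (\<epsilon> k) g (u (Suc k))" for k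
    using exit[of k] eps_solution_imp_eps_subdiff[OF g(1)] by auto
  have uS: "u (Suc k) \<in> edom g" for k
    using vg[of k] by (simp add: eps_subdiff_def)
  have u: "u k \<in> edom g" for k
    using u0 f_fin uS by (cases k) (auto simp: edom_def)
  have w: "w k \<in> edom g" for k
    using step[of k] f_real[OF u] by (intro f_fin) auto
  have Fwu: "F (w k) \<le> F (u k)" for k
    using step[of k] f_real[OF u] f_real[OF w] by simp
  note desc = iadca_descent[OF g(1,3) h(1,3) dom_h w \<epsilon> vg vh conjunct2[OF conjunct2[OF conjunct2[OF exit]]]]
  \<comment> \<open>\<open>S\<close> is determined by the two moduli, so the value obtained at
    iteration 0 serves all iterations.\<close>
  obtain S where S: "sc_modulus g + sc_modulus h = ereal S"
    using desc[of 0] by blast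
  define d where "d k = norm (u (Suc k) - w k)" for k
  have \<epsilon>d: "\<epsilon> k \<le> S / 32 * (d k)\<^sup>2" and Fd: "S / 8 * (d k)\<^sup>2 \<le> F (w k) - F (u (Suc k))" for k
    using desc[of k] S unfolding F_def d_def by auto
  have "S > 0"
    using strong S sc_modulus_nonneg[OF g(3)] sc_modulus_nonneg[OF h(3)]
    by (cases "sc_modulus g"; cases "sc_modulus h") auto
  obtain m where m: "(INF x. g x - h x) = ereal m"
    using inf_f f_real[OF w, of 0] INF_lower[of "w 0" UNIV "\<lambda>x. g x - h x"]
    by (cases "INF x. g x - h x") auto
  have mF: "m \<le> F (w k)" for k
    using INF_lower[of "w k" UNIV "\<lambda>x. g x - h x"] m f_real[OF w] by simp
  \<comment> \<open>Step 1 of the next iteration gives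
    \<open>F (w (Suc k)) \<le> F (u (Suc k))\<close>, so the descent can be followed along
    \<open>w\<close> alone.\<close>
  have dF: "S / 8 * (d k)\<^sup>2 \<le> F (w k) - F (w (Suc k))" for k
    using Fd[of k] Fwu[of "Suc k"] by linarith
  have "decseq (\<lambda>k. F (w k))"
    by (rule decseq_SucI) (use dF \<open>S > 0\<close> in \<open>smt (verit) divide_nonneg_pos mult_nonneg_nonneg zero_le_power2\<close>)
  then obtain L where L: "(\<lambda>k. F (w k)) \<longlonglongrightarrow> L"
    using decseq_convergent mF by metis
  have "(\<lambda>k. 8 / S * (F (w k) - F (w (Suc k)))) \<longlonglongrightarrow> 8 / S * (L - L)"
    by (intro tendsto_intros L LIMSEQ_Suc[OF L])
  then have lim0: "(\<lambda>k. 8 / S * (F (w k) - F (w (Suc k)))) \<longlonglongrightarrow> 0"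
    by simp
  have "norm ((d k)\<^sup>2) \<le> 8 / S * (F (w k) - F (w (Suc k)))" for k
    using dF[of k] \<open>S > 0\<close> by (simp add: field_simps)
  then have d2: "(\<lambda>k. (d k)\<^sup>2) \<longlonglongrightarrow> 0"
    by (intro Lim_null_comparison[OF always_eventually lim0]) simp
  then have d0: "d \<longlonglongrightarrow> 0"
    by (simp add: power_tendsto_0_iff)
  have "(\<lambda>k. S / 32 * (d k)\<^sup>2) \<longlonglongrightarrow> 0"
    using tendsto_mult_right_zero[OF d2] .
  then have \<epsilon>0: "\<epsilon> \<longlonglongrightarrow> 0"
    by (rule Lim_null_comparison[rotated]) (use \<epsilon>d less_imp_le[OF \<epsilon>] in auto)
  have uw0: "(\<lambda>k. u (Suc k) - w k) \<longlonglongrightarrow> 0"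
    using d0 unfolding d_def by (rule tendsto_norm_zero_cancel)
  have "bounded (range (\<lambda>k. u (Suc k)))"
    using u_bdd by (rule bounded_subset) auto
  \<comment> \<open>\<open>w k\<close> is written as a bounded sequence minus a null
    sequence.\<close>
  then have "bounded (range (\<lambda>k. u (Suc k) - (u (Suc k) - w k)))"
    using convergent_imp_bounded[OF uw0] by (rule bounded_minus_comp)
  then have "bounded (range w)"
    by simp
  obtain E where "\<And>k. \<bar>\<epsilon> k\<bar> \<le> E"
    using convergent_imp_bounded[OF \<epsilon>0] by (auto simp: bounded_iff)
  then have v_bdd: "bounded (range v)"
    using bounded_eps_subdiff_range[OF h(1) dom_h h_bdd \<open>bounded (range w)\<close> abs_le_D1 vh] by blast
  moreover have "critical_point g h x" if r: "strict_mono r" and lim: "(u \<circ> r) \<longlonglongrightarrow> x" for r x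
  proof -
    \<comment> \<open>The subgradient condition for \<open>g\<close> in iteration \<open>k\<close>
      holds at \<open>u (Suc k)\<close>, so the indices are lowered by one. Dropping
      \<open>r 0\<close>, which may be 0, makes this possible.\<close>
    define s where "s j = r (Suc j) - 1" for j
    have Suc_s: "Suc (s j) = r (Suc j)" for j
      using strict_mono_less[OF r, of 0 "Suc j"] by (simp add: s_def)
    have "strict_mono s"
      by (rule strict_monoI) (metis Suc_s Suc_less_eq r strict_mono_less)
    have X: "(\<lambda>j. u (Suc (s j))) \<longlonglongrightarrow> x"
      unfolding Suc_s using LIMSEQ_Suc[OF lim] by (simp add: comp_def)
    have "(\<lambda>j. u (Suc (s j)) - w (s j)) \<longlonglongrightarrow> 0"
      using LIMSEQ_subseq_LIMSEQ[OF uw0 \<open>strict_mono s\<close>] by (simp add: comp_def)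
    from tendsto_diff[OF X this] have Y: "(\<lambda>j. w (s j)) \<longlonglongrightarrow> x"
      by simp
    have "(\<lambda>j. \<epsilon> (s j)) \<longlonglongrightarrow> 0"
      using LIMSEQ_subseq_LIMSEQ[OF \<epsilon>0 \<open>strict_mono s\<close>] by (simp add: comp_def)
    then show ?thesis
      by (rule critical_point_limit[OF g(1,2) h(1,2) X Y _ vg vh])
        (use v_bdd in \<open>auto intro: bounded_subset\<close>)
  qed
  ultimately show ?thesis
    by blast
qed

end
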